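(* For any graph $G$, $\chi'^t_d(G^{\frac{1}{2}})\leq \chi'^t_d(G^{\frac{1}{3}})$.
   Context: Graphs are simple. Two edges are adjacent if they are distinct and share an endpoint. A total dominator edge coloring (TDE-coloring) of a graph $G$ is a proper edge coloring of $G$ in which each edge of $G$ is adjacent to every edge of some color class (a color class is the set of all edges assigned a given used color). The total dominator edge chromatic number $\chi'^t_d(G)$ is the minimum number of color classes in a TDE-coloring of $G$. For a positive integer $k$, the $k$-subdivision $G^{\frac{1}{k}}$ of $G$ is the graph obtained by replacing each edge of $G$ with a path of length $k$ (i.e. with $k$ edges and $k-1$ new internal vertices) between its endpoints. *)

theory Defs
  imports "HOL-Library.Ramsey" "HOL-Library.Multiset" "HOL-Library.Extended_Nat"
begin

type_synonym 'a graph = "'a set \<times> 'a set set"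

abbreviation vertices :: "'a graph \<Rightarrow> 'a set" where
  "vertices G \<equiv> fst G"

abbreviation edges :: "'a graph \<Rightarrow> 'a set set" where
  "edges G \<equiv> snd G"

definition simple_graph :: "'a graph \<Rightarrow> bool" where
  "simple_graph G \<longleftrightarrow> edges G \<subseteq> [vertices G]\<^bsup>2\<^esup>"

definition adjacent_edges :: "'a set \<Rightarrow> 'a set \<Rightarrow> bool" where
  "adjacent_edges e f \<longleftrightarrow> e \<noteq> f \<and> e \<inter> f \<noteq> {}"

definition proper_edge_coloring :: "'a graph \<Rightarrow> ('a set \<Rightarrow> 'c) \<Rightarrow> bool" where
  "proper_edge_coloring G c \<longleftrightarrow>
     (\<forall>e\<in>edges G. \<forall>f\<in>edges G. adjacent_edges e f \<longrightarrow> c e \<noteq> c f)"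

definition color_classes :: "'a graph \<Rightarrow> ('a set \<Rightarrow> 'c) \<Rightarrow> 'a set set set" where
  "color_classes G c = {{f \<in> edges G. c f = a} | a. a \<in> c ` edges G}"

definition tde_coloring :: "'a graph \<Rightarrow> ('a set \<Rightarrow> 'c) \<Rightarrow> bool" where
  "tde_coloring G c \<longleftrightarrow> proper_edge_coloring G c \<and>
     (\<forall>e\<in>edges G. \<exists>C\<in>color_classes G c. \<forall>f\<in>C. adjacent_edges e f)"

text \<open>
  The minimum is taken in \<^typ>\<open>enat\<close>, where the infimum of a nonempty set is attained. It
  is \<open>\<infinity>\<close> exactly when no TDE-coloring has finitely many color classes: if some edge is
  adjacent to no other edge, or if there are infinitely many edges. Since only finite numbers
  of classes enter, colors can be taken to be natural numbers.
\<close>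

definition tde_chromatic_number :: "'a graph \<Rightarrow> enat" where
  "tde_chromatic_number G =
     Inf {enat (card (color_classes G c)) | c :: 'a set \<Rightarrow> nat.
            tde_coloring G c \<and> finite (color_classes G c)}"

text \<open>
  The vertex at distance \<open>i\<close> from \<open>u\<close> on the path of length \<open>k\<close> that replaces the edge
  \<open>{u, v}\<close> is encoded by its barycentric coordinates: \<open>k - i\<close> copies of \<open>u\<close> and \<open>i\<close>
  copies of \<open>v\<close>. This does not depend on an orientation of the edge, and the original
  vertex \<open>u\<close> becomes the multiset of \<open>k\<close> copies of \<open>u\<close>.
\<close>

definition path_vertex :: "nat \<Rightarrow> 'a \<Rightarrow> 'a \<Rightarrow> nat \<Rightarrow> 'a multiset" where
  "path_vertex k u v i = replicate_mset (k - i) u + replicate_mset i v"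

definition subdivision :: "nat \<Rightarrow> 'a graph \<Rightarrow> 'a multiset graph" where
  "subdivision k G =
     (replicate_mset k ` vertices G \<union>
        {path_vertex k u v i | u v i. {u, v} \<in> edges G \<and> 0 < i \<and> i < k},
      {{path_vertex k u v i, path_vertex k u v (Suc i)} | u v i. {u, v} \<in> edges G \<and> i < k})"

lemma path_vertex_0: "path_vertex k u v 0 = replicate_mset k u"
  by (simp add: path_vertex_def)

lemma path_vertex_end: "path_vertex k u v k = replicate_mset k v"
  by (simp add: path_vertex_def)

lemma path_vertex_swap: "i \<le> k \<Longrightarrow> path_vertex k u v i = path_vertex k v u (k - i)"
  by (simp add: path_vertex_def add.commute)

lemma path_vertex_inj:
  assumes "u \<noteq> v" "path_vertex k u v i = path_vertex k u v j"
  shows "i = j"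
  using arg_cong[OF assms(2), of "\<lambda>M. count M v"] assms(1)
  by (simp add: path_vertex_def)

text \<open>Interior vertices determine the edge they subdivide.\<close>

lemma set_path_vertex: "0 < i \<Longrightarrow> i < k \<Longrightarrow> set_mset (path_vertex k u v i) = {u, v}"
  by (auto simp: path_vertex_def)

lemma simple_graph_subdivision:
  assumes "simple_graph G"
  shows "simple_graph (subdivision k G)"
proof -
  have uv: "u \<noteq> v \<and> u \<in> vertices G \<and> v \<in> vertices G" if "{u, v} \<in> edges G" for u v
  proof -
    have "{u, v} \<in> [vertices G]\<^bsup>2\<^esup>"
      using assms that unfolding simple_graph_def by blast
    then show ?thesis
      by (cases "u = v") (auto simp: nsets_def)
  qed
  have mem: "path_vertex k u v i \<in> vertices (subdivision k G)"
    if e: "{u, v} \<in> edges G" and i: "i \<le> k" for u v i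
  proof (cases "0 < i \<and> i < k")
    case True
    then show ?thesis
      using e by (auto simp: subdivision_def)
  next
    case False
    then have "i = 0 \<or> i = k"
      using i by auto
    then show ?thesis
      using uv[OF e] by (auto simp: subdivision_def path_vertex_0 path_vertex_end)
  qed
  have "{path_vertex k u v i, path_vertex k u v (Suc i)} \<in> [vertices (subdivision k G)]\<^bsup>2\<^esup>"
    if e: "{u, v} \<in> edges G" and i: "i < k" for u v i
  proof -
    have "path_vertex k u v i \<noteq> path_vertex k u v (Suc i)"
      using path_vertex_inj uv[OF e] by (metis n_not_Suc_n)
    then show ?thesis
      using mem[OF e, of i] mem[OF e, of "Suc i"] i by (simp add: nsets_def)
  qed
  then show ?thesis
    unfolding simple_graph_def by (auto simp: subdivision_def)
qed

end

theory Submission imports Defs begin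

text \<open>
  An edge \<open>e = {u, v}\<close> of \<open>G\<close> becomes in \<open>G\<^sup>1\<^sup>/\<^sup>3\<close> two end edges, \<open>h(u, v)\<close> at \<open>u\<close> and
  \<open>h(v, u)\<close> at \<open>v\<close>, and a middle edge \<open>m(e)\<close>; in \<open>G\<^sup>1\<^sup>/\<^sup>2\<close> it becomes the two end edges
  alone, now adjacent to each other. From a TDE-coloring of \<open>G\<^sup>1\<^sup>/\<^sup>3\<close> with finitely many colors
  a TDE-coloring of \<open>G\<^sup>1\<^sup>/\<^sup>2\<close> with the same palette is built, essentially by contracting the
  middle edges.

  Domination of \<open>m(e)\<close> forces a color \<open>\<alpha> e\<close> whose class lies inside \<open>{h(u, v), h(v, u)}\<close>:
  every edge of \<open>G\<close> owns a private color. Domination of \<open>h(u, v)\<close> forces a class inside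
  \<open>{m(e)} \<union> {h(u, w) | w \<noteq> v}\<close>, and such a class has at most one end edge. If it has one,
  that end edge still dominates \<open>h(u, v)\<close> after the contraction, so two things can go wrong:
  the class is just \<open>{m(e)}\<close> and vanishes, or the two ends of an edge have the same color.

  Suppose that the class of \<open>m(e)\<close> is \<open>{m(e)}\<close>, or that the ends of \<open>e\<close> agree and this class
  is \<open>{m(e), h(v, w)}\<close>. Then give \<open>h(u, v)\<close> the color of \<open>m(e)\<close> and \<open>h(v, u)\<close> the color
  \<open>\<alpha> e\<close>: the new class \<open>{h(v, u)}\<close> dominates \<open>h(u, v)\<close>, and the new class of \<open>h(u, v)\<close>,
  which contains at most \<open>h(v, w)\<close> besides, dominates \<open>h(v, u)\<close>. The colors of ends that differ
  are otherwise kept.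

  The remaining edges whose ends agree are called bad: both ends have the color \<open>\<alpha> e\<close>, and the
  class of \<open>m(e)\<close> dominates nothing. Then \<open>\<alpha> e\<close> and the color \<open>b\<close> of one such middle edge are free to
  be used in any proper way. Bad edges are inserted one at a time: \<open>h(v, u)\<close> gets \<open>\<alpha> e\<close>,
  \<open>h(u, v)\<close> gets \<open>b\<close>, and an edge \<open>h(u, w)\<close> that had \<open>b\<close> before is moved to \<open>\<alpha> e\<close>. Lemma
  \<open>proper_arcs_insert_edges\<close> carries out this insertion, \<open>recolor_dominated\<close> provides
  every end edge with a dominating class whose color the insertion does not use, and
  \<open>thirds_coloring_of_tde_coloring\<close> and \<open>tde_coloring_halves\<close> translate between the subdivisions and arcs of \<open>G\<close>.
\<close>

section \<open>Proper colorings of arcs\<close>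

text \<open>
  An ordered pair \<open>(u, v)\<close> with \<open>{u, v} \<in> E\<close>, called an arc, stands for the end edge at \<open>u\<close> of
  the path that replaces \<open>{u, v}\<close>. The two conjuncts are the two ways in which end edges can be
  adjacent in the 2-subdivision: at the subdivision vertex and at an original vertex.
\<close>

definition proper_arcs :: "'a set set \<Rightarrow> ('a \<Rightarrow> 'a \<Rightarrow> 'c) \<Rightarrow> bool" where
  "proper_arcs E K \<longleftrightarrow> (\<forall>u v. {u, v} \<in> E \<longrightarrow> K u v \<noteq> K v u) \<and>
     (\<forall>u v w. {u, v} \<in> E \<longrightarrow> {u, w} \<in> E \<longrightarrow> v \<noteq> w \<longrightarrow> K u v \<noteq> K u w)"

text \<open>
  In the 2-subdivision the edge of the arc \<open>(u, v)\<close> is adjacent to every edge of the class of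
  \<open>c\<close>, which has to be nonempty because color classes are classes of used colors.
\<close>

definition dominating_color :: "'a set set \<Rightarrow> ('a \<Rightarrow> 'a \<Rightarrow> 'c) \<Rightarrow> 'a \<Rightarrow> 'a \<Rightarrow> 'c \<Rightarrow> bool" where
  "dominating_color E K u v c \<longleftrightarrow> (\<exists>x y. {x, y} \<in> E \<and> K x y = c) \<and>
     (\<forall>x y. {x, y} \<in> E \<longrightarrow> K x y = c \<longrightarrow> x = v \<and> y = u \<or> x = u \<and> y \<noteq> v)"

text \<open>
  Arcs colored \<open>b\<close> are the only old ones whose color changes. A new edge \<open>{p, q}\<close> receives its
  fresh color on \<open>(q, p)\<close> and \<open>b\<close> on \<open>(p, q)\<close>; should some \<open>(p, w)\<close> have \<open>b\<close> already, it takes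
  the fresh color, which occurs neither on \<open>(w, p)\<close> nor on another arc out of \<open>p\<close>.
\<close>

lemma proper_arcs_insert_edges:
  fixes K0 :: "'a \<Rightarrow> 'a \<Rightarrow> 'c"
  assumes "finite B" "\<And>e. e \<in> B \<Longrightarrow> \<exists>p q. e = {p, q} \<and> p \<noteq> q"
    and "inj_on \<alpha> B" "b \<notin> \<alpha> ` B" "E \<inter> B = {}"
    and "proper_arcs E K0"
    and "\<And>u v. {u, v} \<in> E \<Longrightarrow> K0 u v \<notin> \<alpha> ` B"
  shows "\<exists>K. proper_arcs (E \<union> B) K \<and>
    (\<forall>u v. {u, v} \<in> E \<union> B \<longrightarrow>
       (if {u, v} \<in> E \<and> K0 u v \<noteq> b then K u v = K0 u v else K u v \<in> insert b (\<alpha> ` B)))"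
  using assms
proof (induction B rule: finite_induct)
  case empty
  then show ?case by (intro exI[of _ K0]) auto
next
  case (insert e F)
  have "\<exists>K. proper_arcs (E \<union> F) K \<and> (\<forall>u v. {u, v} \<in> E \<union> F \<longrightarrow>
       (if {u, v} \<in> E \<and> K0 u v \<noteq> b then K u v = K0 u v else K u v \<in> insert b (\<alpha> ` F)))"
  proof (rule insert.IH)
    show "\<exists>p q. f = {p, q} \<and> p \<noteq> q" if "f \<in> F" for f using insert.prems(1) that by blast
    show "inj_on \<alpha> F" using insert.prems(2) by simp
    show "b \<notin> \<alpha> ` F" using insert.prems(3) by simp
    show "E \<inter> F = {}" using insert.prems(4) by simp
    show "proper_arcs E K0" by (rule insert.prems(5))
    show "K0 u v \<notin> \<alpha> ` F" if "{u, v} \<in> E" for u v using insert.prems(6)[OF that] by simp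
  qed
  then obtain K where *: "proper_arcs (E \<union> F) K \<and> (\<forall>u v. {u, v} \<in> E \<union> F \<longrightarrow>
       (if {u, v} \<in> E \<and> K0 u v \<noteq> b then K u v = K0 u v else K u v \<in> insert b (\<alpha> ` F)))" ..
  note K = conjunct1[OF *] and KF = conjunct2[OF *, rule_format]
  obtain p q where e: "e = {p, q}" "p \<noteq> q" using insert.prems(1)[of e] by blast
  have \<alpha>e: "\<alpha> e \<notin> \<alpha> ` F" using insert.prems(2) insert.hyps(2) by simp
  have fresh: "K u v \<noteq> \<alpha> e" if "{u, v} \<in> E \<union> F" for u v
    using KF[OF that] insert.prems(3) insert.prems(6)[of u v] \<alpha>e
    by (cases "K u v = \<alpha> e") (simp_all split: if_splits)
  have new: "e \<notin> E \<union> F" using insert.hyps(2) insert.prems(4) by auto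
  have b: "b \<noteq> \<alpha> e" using insert.prems(3) by auto
  define L where "L u v = (if u = q \<and> v = p then \<alpha> e else if u = p \<and> v = q then b
     else if u = p \<and> K u v = b then \<alpha> e else K u v)" for u v
  have K1: "K u v \<noteq> K v u" if "{u, v} \<in> E \<union> F" for u v
    using K that unfolding proper_arcs_def by blast
  have K2: "K u v \<noteq> K u w" if "{u, v} \<in> E \<union> F" "{u, w} \<in> E \<union> F" "v \<noteq> w" for u v w
    using K that unfolding proper_arcs_def by blast
  have Le: "L p q = b" "L q p = \<alpha> e" using e by (auto simp: L_def)
  have Lo: "L u v = (if u = p \<and> K u v = b then \<alpha> e else K u v)" if "{u, v} \<in> E \<union> F" for u v
    using that new e by (auto simp: L_def insert_commute)
  have "proper_arcs (E \<union> insert e F) L"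
    unfolding proper_arcs_def
  proof (intro conjI allI impI)
    fix u v assume a: "{u, v} \<in> E \<union> insert e F"
    show "L u v \<noteq> L v u"
    proof (cases "{u, v} = e")
      case True
      then show ?thesis using e Le b by (auto simp: doubleton_eq_iff)
    next
      case False
      then have a: "{u, v} \<in> E \<union> F" "{v, u} \<in> E \<union> F" using a by (auto simp: insert_commute)
      then show ?thesis using Lo[OF a(1)] Lo[OF a(2)] K1[OF a(1)] fresh[OF a(1)] fresh[OF a(2)]
        by auto
    qed
  next
    fix u v w assume a: "{u, v} \<in> E \<union> insert e F" "{u, w} \<in> E \<union> insert e F" "v \<noteq> w"
    have aux: "L u v \<noteq> L u w" if "{u, v} = e" "{u, w} \<in> E \<union> F" for v w
      using that e Le b Lo[OF that(2)] fresh[OF that(2)] by (auto simp: doubleton_eq_iff)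
    show "L u v \<noteq> L u w"
    proof (cases "{u, v} = e"; cases "{u, w} = e")
      assume "{u, v} = e" "{u, w} = e"
      then show ?thesis using a(3) e by (auto simp: doubleton_eq_iff)
    next
      assume "{u, v} = e" "{u, w} \<noteq> e"
      then show ?thesis using a aux by auto
    next
      assume "{u, v} \<noteq> e" "{u, w} = e"
      then show ?thesis using a aux[of w v] by auto
    next
      assume "{u, v} \<noteq> e" "{u, w} \<noteq> e"
      then have a': "{u, v} \<in> E \<union> F" "{u, w} \<in> E \<union> F" using a by auto
      show ?thesis using Lo[OF a'(1)] Lo[OF a'(2)] K2[OF a' a(3)] fresh[OF a'(1)] fresh[OF a'(2)]
        by auto
    qed
  qed
  moreover have "if {u, v} \<in> E \<and> K0 u v \<noteq> b then L u v = K0 u v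
      else L u v \<in> insert b (\<alpha> ` insert e F)"
    if a: "{u, v} \<in> E \<union> insert e F" for u v
  proof (cases "{u, v} = e")
    case True
    then have "u = p \<and> v = q \<or> u = q \<and> v = p" using e(1) by (simp add: doubleton_eq_iff)
    then have "L u v \<in> insert b (\<alpha> ` insert e F)" using Le by auto
    then show ?thesis using True new by simp
  next
    case False
    then have "{u, v} \<in> E \<union> F" using a by auto
    then show ?thesis using Lo[of u v] KF[of u v] by (auto split: if_splits)
  qed
  ultimately show ?case by blast
qed

section \<open>Contracting the middle edges\<close>

text \<open>
  What a TDE-coloring of the 3-subdivision says about the colors \<open>H u v\<close> of the end edges and
  \<open>M e\<close> of the middle edges. The color \<open>\<alpha> e\<close> is one whose class dominates the middle edge of
  \<open>e\<close>; since the only neighbours of that edge are the two ends of \<open>e\<close>, it is private to \<open>e\<close>.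
\<close>

locale thirds_coloring =
  fixes E :: "'a set set" and H :: "'a \<Rightarrow> 'a \<Rightarrow> 'c" and M :: "'a set \<Rightarrow> 'c"
    and \<alpha> :: "'a set \<Rightarrow> 'c"
  assumes edge_doubleton: "e \<in> E \<Longrightarrow> \<exists>u v. e = {u, v} \<and> u \<noteq> v"
    and H_neq_H: "{u, v} \<in> E \<Longrightarrow> {u, w} \<in> E \<Longrightarrow> v \<noteq> w \<Longrightarrow> H u v \<noteq> H u w"
    and H_neq_M: "{u, v} \<in> E \<Longrightarrow> H u v \<noteq> M {u, v}"
    and \<alpha>_used: "{u, v} \<in> E \<Longrightarrow> \<alpha> {u, v} = H u v \<or> \<alpha> {u, v} = H v u"
    and \<alpha>_private: "e \<in> E \<Longrightarrow> {x, y} \<in> E \<Longrightarrow> H x y = \<alpha> e \<Longrightarrow> {x, y} = e"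
    and \<alpha>_neq_M: "e \<in> E \<Longrightarrow> f \<in> E \<Longrightarrow> M f \<noteq> \<alpha> e"
    and end_dominated: "{u, v} \<in> E \<Longrightarrow> \<exists>b.
       (b = M {u, v} \<or> (\<exists>w. w \<noteq> v \<and> {u, w} \<in> E \<and> b = H u w)) \<and>
       (\<forall>x y. {x, y} \<in> E \<longrightarrow> H x y = b \<longrightarrow> x = u \<and> y \<noteq> v) \<and>
       (\<forall>f\<in>E. M f = b \<longrightarrow> f = {u, v})"
begin

text \<open>
  The color of the middle edge can be moved to the end edge at \<open>u\<close>. The end edges of its class
  have to be at \<open>v\<close>, where by properness there is at most one; it does not touch the end edge
  at \<open>u\<close> and is adjacent to the one at \<open>v\<close>. When there is one, \<open>H u v = H v u\<close> is demanded: if the colors differ, one of the ends may be a class on its own that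
  dominates a third arc, and recoloring the ends could destroy it.
\<close>

definition movable :: "'a \<Rightarrow> 'a \<Rightarrow> bool" where
  "movable u v \<longleftrightarrow> {u, v} \<in> E \<and> (\<forall>f\<in>E. M f = M {u, v} \<longrightarrow> f = {u, v}) \<and>
     (\<forall>x y. {x, y} \<in> E \<longrightarrow> H x y = M {u, v} \<longrightarrow> x = v \<and> H u v = H v u)"

text \<open>
  Both orientations of an edge are movable exactly when the middle edge is a class by itself; the
  choice operator then picks one of them.
\<close>

definition tail :: "'a \<Rightarrow> 'a \<Rightarrow> bool" where
  "tail u v \<longleftrightarrow> movable u v \<and> (movable v u \<longrightarrow> (SOME x. x \<in> {u, v}) = u)"

definition bad_edges :: "'a set set" where
  "bad_edges = {{u, v} | u v. {u, v} \<in> E \<and> \<not> movable u v \<and> \<not> movable v u \<and> H u v = H v u}"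

definition recolor :: "'a \<Rightarrow> 'a \<Rightarrow> 'c" where
  "recolor u v = (if tail u v then M {u, v} else if tail v u then \<alpha> {u, v} else H u v)"

lemma arc_neq: "{u, v} \<in> E \<Longrightarrow> u \<noteq> v"
  using edge_doubleton[of "{u, v}"] by (auto simp: doubleton_eq_iff)

lemma \<alpha>_inj: "e \<in> E \<Longrightarrow> f \<in> E \<Longrightarrow> \<alpha> e = \<alpha> f \<Longrightarrow> e = f"
proof -
  assume e: "e \<in> E" and f: "f \<in> E" and eq: "\<alpha> e = \<alpha> f"
  obtain u v where uv: "e = {u, v}" using edge_doubleton[OF e] by blast
  have vu: "{v, u} = e" using uv by blast
  show "e = f"
    using \<alpha>_used[of u v] \<alpha>_private[OF f, of u v] \<alpha>_private[OF f, of v u] e eq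
    unfolding vu uv[symmetric] by argo
qed

lemma movable_edge: "movable u v \<Longrightarrow> {u, v} \<in> E \<and> {v, u} \<in> E"
  by (auto simp: movable_def insert_commute)

lemma tail_cases: "movable u v \<Longrightarrow> tail u v \<or> tail v u"
proof -
  have "(SOME x. x \<in> {u, v}) \<in> {u, v}" by (rule someI_ex) auto
  then show "movable u v \<Longrightarrow> tail u v \<or> tail v u"
    by (auto simp: tail_def insert_commute)
qed

lemma tail_movable: "tail u v \<Longrightarrow> movable u v"
  by (simp add: tail_def)

lemma tail_asym: "tail u v \<Longrightarrow> \<not> tail v u"
  using arc_neq movable_edge by (auto simp: tail_def insert_commute)

lemma bad_edge_iff:
  "{u, v} \<in> bad_edges \<longleftrightarrow> {u, v} \<in> E \<and> \<not> movable u v \<and> \<not> movable v u \<and> H u v = H v u"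
  unfolding bad_edges_def by (auto simp: doubleton_eq_iff insert_commute)

lemma bad_edges_sub: "bad_edges \<subseteq> E"
  by (auto simp: bad_edges_def)

lemma recolor_tail: "tail u v \<Longrightarrow> recolor u v = M {u, v}"
  by (simp add: recolor_def)

lemma recolor_head: "tail u v \<Longrightarrow> recolor v u = \<alpha> {u, v}"
  using tail_asym by (auto simp: recolor_def insert_commute)

lemma recolor_keep: "\<not> movable u v \<Longrightarrow> \<not> movable v u \<Longrightarrow> recolor u v = H u v"
  by (auto simp: recolor_def tail_def)

lemma recolor_cases:
  assumes "{x, y} \<in> E - bad_edges"
  obtains (tail) "tail x y" "recolor x y = M {x, y}"
  | (head) "tail y x" "recolor x y = \<alpha> {x, y}"
  | (keep) "\<not> movable x y" "\<not> movable y x" "recolor x y = H x y" "H x y \<noteq> H y x"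
  using assms bad_edge_iff[of x y] tail_cases[of x y] tail_cases[of y x]
    recolor_tail[of x y] recolor_head[of y x] recolor_keep[of x y]
  by (auto simp: insert_commute)

lemma recolor_eq_\<alpha>:
  assumes "{x, y} \<in> E - bad_edges" "e \<in> E" "recolor x y = \<alpha> e"
  shows "{x, y} = e"
  using assms(1)
proof (cases rule: recolor_cases)
  case tail
  then show ?thesis using assms \<alpha>_neq_M[of e "{x, y}"] by simp
next
  case head
  then show ?thesis using assms \<alpha>_inj by auto
next
  case keep
  then show ?thesis using assms \<alpha>_private by auto
qed

text \<open>
  The class that the moved color of a middle edge ends up with. All its members are adjacent to
  the arc \<open>(v, u)\<close>, so this class dominates that arc.
\<close>

lemma recolor_eq_M:
  assumes xy: "{x, y} \<in> E - bad_edges" and g: "tail u v" and c: "recolor x y = M {u, v}"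
  shows "x = u \<and> y = v \<or> x = v \<and> y \<noteq> u \<and> H x y = M {u, v}"
  using assms(1)
proof (cases rule: recolor_cases)
  case tail
  have "{x, y} = {u, v}" using tail xy c tail_movable[OF g] unfolding movable_def by auto
  then show ?thesis using tail g tail_asym by (auto simp: doubleton_eq_iff)
next
  case head
  have "M {u, v} \<noteq> \<alpha> {x, y}" using \<alpha>_neq_M movable_edge[OF tail_movable[OF g]] xy by blast
  then show ?thesis using head(2) c by simp
next
  case keep
  have "x = v" using keep(3) xy c tail_movable[OF g] unfolding movable_def by (metis DiffD1)
  moreover have "y \<noteq> u" using H_neq_M[of v u] keep(3) c xy calculation by (auto simp: insert_commute)
  ultimately show ?thesis using keep c by auto
qed

lemma proper_recolor: "proper_arcs (E - bad_edges) recolor"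
  unfolding proper_arcs_def
proof (intro conjI allI impI)
  fix u v assume a: "{u, v} \<in> E - bad_edges"
  then show "recolor u v \<noteq> recolor v u"
  proof (cases rule: recolor_cases)
    case tail
    then show ?thesis using recolor_head[of u v] \<alpha>_neq_M[of "{u, v}" "{u, v}"] a by simp
  next
    case head
    then show ?thesis
      using recolor_tail[of v u] \<alpha>_neq_M[of "{u, v}" "{u, v}"] a by (simp add: insert_commute)
  next
    case keep
    then show ?thesis using recolor_keep[of v u] by auto
  qed
next
  fix u v w assume a: "{u, v} \<in> E - bad_edges" "{u, w} \<in> E - bad_edges" "v \<noteq> w"
  have uv: "u \<noteq> v" "u \<noteq> w" using a arc_neq by auto
  show "recolor u v \<noteq> recolor u w"
    using a(1)
  proof (cases rule: recolor_cases)
    case tail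
    then show ?thesis using recolor_eq_M[OF a(2) tail(1)] uv a(3) by auto
  next
    case head
    then show ?thesis using recolor_eq_\<alpha>[OF a(2), of "{u, v}"] a uv
      by (auto simp: doubleton_eq_iff)
  next
    case uv_keep: keep
    show ?thesis
      using a(2)
    proof (cases rule: recolor_cases)
      case tail
      then show ?thesis using recolor_eq_M[OF a(1) tail(1)] uv a(3) by auto
    next
      case head
      then show ?thesis using recolor_eq_\<alpha>[OF a(1), of "{u, w}"] a uv
        by (auto simp: doubleton_eq_iff)
    next
      case keep
      then show ?thesis using uv_keep H_neq_H a by auto
    qed
  qed
qed

text \<open>
  On an edge whose middle color has been moved, each end is dominated by the class of the other
  one. For any other edge \<open>{u, v}\<close>, bad ones included, the class that dominated \<open>(u, v)\<close> in the
  3-subdivision cannot be the middle edge alone, as that would make \<open>{u, v}\<close> movable. So it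
  contains an end edge \<open>(u, w)\<close>, whose color after recoloring dominates \<open>(u, v)\<close>. The colors in
  \<open>\<alpha> ` bad_edges \<union> M ` bad_edges\<close> are those that the insertion of the bad edges may use.
\<close>

lemma recolor_dominated:
  assumes "{u, v} \<in> E"
  shows "\<exists>c. c \<notin> \<alpha> ` bad_edges \<union> M ` bad_edges \<and>
    dominating_color (E - bad_edges) recolor u v c"
proof -
  have M_ok: "M {x, y} \<notin> \<alpha> ` bad_edges \<union> M ` bad_edges" and
    \<alpha>_ok: "\<alpha> {x, y} \<notin> \<alpha> ` bad_edges \<union> M ` bad_edges" and
    nb: "{x, y} \<in> E - bad_edges" if "tail x y" for x y
  proof -
    have g: "movable x y" using that by (rule tail_movable)
    have e: "{x, y} \<in> E" using g movable_edge by blast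
    have n: "{x, y} \<notin> bad_edges" using g bad_edge_iff by blast
    show "{x, y} \<in> E - bad_edges" using e n by blast
    show "M {x, y} \<notin> \<alpha> ` bad_edges \<union> M ` bad_edges"
    proof
      assume "M {x, y} \<in> \<alpha> ` bad_edges \<union> M ` bad_edges"
      then obtain f where f: "f \<in> bad_edges" "M {x, y} = \<alpha> f \<or> M {x, y} = M f" by blast
      then have "f \<in> E" using bad_edges_sub by blast
      then have "M f = M {x, y}" using f(2) \<alpha>_neq_M e by metis
      then have "f = {x, y}" using g \<open>f \<in> E\<close> unfolding movable_def by blast
      then show False using f n by blast
    qed
    show "\<alpha> {x, y} \<notin> \<alpha> ` bad_edges \<union> M ` bad_edges"
    proof
      assume "\<alpha> {x, y} \<in> \<alpha> ` bad_edges \<union> M ` bad_edges"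
      then obtain f where f: "f \<in> bad_edges" "\<alpha> {x, y} = \<alpha> f \<or> \<alpha> {x, y} = M f" by blast
      then have "f \<in> E" using bad_edges_sub by blast
      then have "f = {x, y}" using f(2) \<alpha>_neq_M \<alpha>_inj e by metis
      then show False using f n by blast
    qed
  qed
  have \<alpha>_class: "x = w \<and> y = z"
    if "{x, y} \<in> E - bad_edges" "recolor x y = \<alpha> {z, w}" "tail z w" for x y z w
  proof -
    have zw: "{z, w} \<in> E" using nb[OF that(3)] by blast
    then have "{x, y} = {z, w}" using recolor_eq_\<alpha>[OF that(1) _ that(2)] by blast
    moreover have "recolor z w \<noteq> \<alpha> {z, w}"
      using recolor_tail[OF that(3)] \<alpha>_neq_M[OF zw zw] by simp
    ultimately show ?thesis using that(2) by (auto simp: doubleton_eq_iff)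
  qed
  consider (tail) "tail u v" | (head) "tail v u" | (keep) "\<not> movable u v" "\<not> movable v u"
    using tail_cases by blast
  then show ?thesis
  proof cases
    case tail
    show ?thesis
      unfolding dominating_color_def
    proof (intro exI[of _ "\<alpha> {u, v}"] conjI)
      show "\<alpha> {u, v} \<notin> \<alpha> ` bad_edges \<union> M ` bad_edges" by (rule \<alpha>_ok[OF tail])
      have "{v, u} \<in> E - bad_edges" using nb[OF tail] by (simp add: insert_commute)
      then show "\<exists>x y. {x, y} \<in> E - bad_edges \<and> recolor x y = \<alpha> {u, v}"
        using recolor_head[OF tail] by blast
    qed (use \<alpha>_class[OF _ _ tail] in blast)
  next
    case head
    show ?thesis
      unfolding dominating_color_def
    proof (intro exI[of _ "M {v, u}"] conjI)
      show "M {v, u} \<notin> \<alpha> ` bad_edges \<union> M ` bad_edges" by (rule M_ok[OF head])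
      show "\<exists>x y. {x, y} \<in> E - bad_edges \<and> recolor x y = M {v, u}"
        using nb[OF head] recolor_tail[OF head] by blast
    qed (use recolor_eq_M[OF _ head] in blast)
  next
    case keep
    obtain c where c: "c = M {u, v} \<or> (\<exists>w. w \<noteq> v \<and> {u, w} \<in> E \<and> c = H u w)"
      and cH: "\<And>x y. {x, y} \<in> E \<Longrightarrow> H x y = c \<Longrightarrow> x = u \<and> y \<noteq> v"
      and cM: "\<And>f. f \<in> E \<Longrightarrow> M f = c \<Longrightarrow> f = {u, v}"
      using end_dominated[OF assms] by blast
    obtain w where w: "w \<noteq> v" "{u, w} \<in> E" "c = H u w"
    proof (cases "\<exists>w. w \<noteq> v \<and> {u, w} \<in> E \<and> c = H u w")
      case False
      then have "movable u v"
        using c cH cM assms unfolding movable_def by metis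
      then show ?thesis using keep by blast
    qed (use that in blast)
    have uw: "u \<noteq> w" using w arc_neq by auto
    \<comment> \<open>Otherwise \<open>(w, u)\<close> would belong to the class of \<open>c\<close> without being adjacent to \<open>(u, v)\<close>.\<close>
    have HH: "H u w \<noteq> H w u"
      using cH[of w u] w uw by (auto simp: insert_commute)
    have nbw: "{u, w} \<in> E - bad_edges" using w HH bad_edge_iff by blast
    show ?thesis
      using nbw
    proof (cases rule: recolor_cases)
      case tail
      \<comment> \<open>The ends of \<open>{u, w}\<close> differ, so its middle edge was a class by itself.\<close>
      have "x = u \<and> y = w" if "{x, y} \<in> E - bad_edges" "recolor x y = M {u, w}" for x y
        using recolor_eq_M[OF that(1) tail(1) that(2)] HH tail_movable[OF tail(1)] that(1)
        unfolding movable_def by blast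
      then show ?thesis unfolding dominating_color_def using M_ok[OF tail(1)] nbw tail w
        by (intro exI[of _ "M {u, w}"]) blast
    next
      case head
      have "x = u \<and> y = w" if "{x, y} \<in> E - bad_edges" "recolor x y = \<alpha> {w, u}" for x y
        using \<alpha>_class[OF that head(1)] .
      then show ?thesis unfolding dominating_color_def using \<alpha>_ok[OF head(1)] nbw head w
        by (intro exI[of _ "\<alpha> {w, u}"]) (auto simp: insert_commute)
    next
      case keep_w: keep
      have 1: "c \<notin> \<alpha> ` bad_edges"
        using \<alpha>_private[OF _ w(2)] w(3) nbw bad_edges_sub by fastforce
      \<comment> \<open>A bad middle edge in this class would be that of \<open>{u, v}\<close>, and the class would then
        have the form that makes \<open>(v, u)\<close> movable.\<close>
      have 2: "c \<notin> M ` bad_edges"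
      proof
        assume "c \<in> M ` bad_edges"
        then obtain e where e: "e \<in> bad_edges" "c = M e" by blast
        then have "e = {u, v}" using cM bad_edges_sub by blast
        then have "movable v u"
          using e cH cM assms bad_edge_iff unfolding movable_def by (metis insert_commute)
        then show False using keep by blast
      qed
      have 3: "x = u \<and> y \<noteq> v" if xy: "{x, y} \<in> E - bad_edges" "recolor x y = c" for x y
        using xy(1)
      proof (cases rule: recolor_cases)
        case tail
        then have "{x, y} = {u, v}" using cM xy by auto
        then show ?thesis using tail keep tail_movable by (auto simp: doubleton_eq_iff)
      next
        case head
        then have "{u, w} = {x, y}" using \<alpha>_private[of "{x, y}" u w] w xy by auto
        then show ?thesis using head keep_w tail_movable by (auto simp: doubleton_eq_iff)
      next
        case keep
        then show ?thesis using cH xy by auto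
      qed
      show ?thesis
        unfolding dominating_color_def
        using 1 2 3 nbw keep_w(3) w(3) by (intro exI[of _ c]) blast
    qed
  qed
qed

definition colors :: "'c set" where
  "colors = {H u v | u v. {u, v} \<in> E} \<union> M ` E"

lemma \<alpha>_in_colors: "e \<in> E \<Longrightarrow> \<alpha> e \<in> colors"
  using edge_doubleton[of e] \<alpha>_used unfolding colors_def by (fastforce simp: insert_commute)

lemma recolor_in_colors: "{u, v} \<in> E \<Longrightarrow> recolor u v \<in> colors"
  using \<alpha>_in_colors unfolding recolor_def colors_def by auto

text \<open>
  The recoloring covers all edges but the bad ones, which are inserted with their private colors
  as fresh colors and the middle color \<open>M e0\<close> of any one bad edge in the role of \<open>b\<close>. Colors
  outside \<open>\<alpha> ` bad_edges \<union> M ` bad_edges\<close> keep their classes, hence their domination.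
\<close>

lemma ex_halves_coloring:
  assumes "finite colors"
  shows "\<exists>K. proper_arcs E K \<and> (\<forall>u v. {u, v} \<in> E \<longrightarrow> K u v \<in> colors) \<and>
    (\<forall>u v. {u, v} \<in> E \<longrightarrow> (\<exists>c. dominating_color E K u v c))"
proof -
  let ?W = "\<alpha> ` bad_edges \<union> M ` bad_edges"
  have W: "?W \<subseteq> colors"
    using \<alpha>_in_colors bad_edges_sub unfolding colors_def by blast
  have inj: "inj_on \<alpha> bad_edges"
    using \<alpha>_inj bad_edges_sub by (auto simp: inj_on_def)
  \<comment> \<open>\<open>E\<close> may be infinite a priori, but each bad edge owns a color and there are finitely many.\<close>
  have fin: "finite bad_edges"
    by (rule finite_imageD[OF _ inj]) (use assms W in \<open>auto intro: finite_subset\<close>)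
  have "\<exists>K. proper_arcs E K \<and> (\<forall>u v. {u, v} \<in> E \<longrightarrow>
     (if {u, v} \<in> E - bad_edges \<and> recolor u v \<notin> ?W then K u v = recolor u v
      else K u v \<in> ?W))"
  proof (cases "bad_edges = {}")
    case True
    then show ?thesis using proper_recolor by auto
  next
    case False
    then obtain e0 where e0: "e0 \<in> bad_edges" by blast
    have E: "E - bad_edges \<union> bad_edges = E" using bad_edges_sub by blast
    have "\<exists>K. proper_arcs (E - bad_edges \<union> bad_edges) K \<and>
      (\<forall>u v. {u, v} \<in> E - bad_edges \<union> bad_edges \<longrightarrow>
       (if {u, v} \<in> E - bad_edges \<and> recolor u v \<noteq> M e0 then K u v = recolor u v
        else K u v \<in> insert (M e0) (\<alpha> ` bad_edges)))"
    proof (rule proper_arcs_insert_edges[OF fin _ inj _ _ proper_recolor])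
      show "\<exists>p q. e = {p, q} \<and> p \<noteq> q" if "e \<in> bad_edges" for e
        using that bad_edges_sub edge_doubleton by blast
      show "M e0 \<notin> \<alpha> ` bad_edges" using \<alpha>_neq_M e0 bad_edges_sub by fastforce
      show "recolor u v \<notin> \<alpha> ` bad_edges" if "{u, v} \<in> E - bad_edges" for u v
        using recolor_eq_\<alpha>[OF that] that bad_edges_sub by blast
    qed auto
    then obtain K where K: "proper_arcs E K"
      and KW: "\<And>u v. {u, v} \<in> E \<Longrightarrow>
        (if {u, v} \<in> E - bad_edges \<and> recolor u v \<noteq> M e0 then K u v = recolor u v
         else K u v \<in> insert (M e0) (\<alpha> ` bad_edges))"
      unfolding E by blast
    have sub: "insert (M e0) (\<alpha> ` bad_edges) \<subseteq> ?W" using e0 by blast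
    have "if {u, v} \<in> E - bad_edges \<and> recolor u v \<notin> ?W then K u v = recolor u v else K u v \<in> ?W"
      if "{u, v} \<in> E" for u v
    proof (cases "{u, v} \<in> E - bad_edges \<and> recolor u v \<noteq> M e0")
      case True
      then have "K u v = recolor u v" using KW[OF that] by (simp split: if_splits)
      then show ?thesis using True by simp
    next
      case False
      then have "K u v \<in> ?W" using KW[OF that] sub by (meson subsetD)
      moreover have "\<not> ({u, v} \<in> E - bad_edges \<and> recolor u v \<notin> ?W)"
        using False sub by blast
      ultimately show ?thesis by argo
    qed
    then show ?thesis using K by blast
  qed
  then obtain K where K: "proper_arcs E K"
    and KW: "\<And>u v. {u, v} \<in> E \<Longrightarrow>
      (if {u, v} \<in> E - bad_edges \<and> recolor u v \<notin> ?W then K u v = recolor u v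
      else K u v \<in> ?W)" by blast
  have "K u v \<in> colors" if "{u, v} \<in> E" for u v
    using KW[OF that] W recolor_in_colors[OF that] by (auto split: if_splits)
  moreover have "\<exists>c. dominating_color E K u v c" if a: "{u, v} \<in> E" for u v
  proof -
    obtain c where c: "c \<notin> ?W" and dom: "dominating_color (E - bad_edges) recolor u v c"
      using recolor_dominated[OF a] by metis
    have iff: "K x y = c \<longleftrightarrow> {x, y} \<in> E - bad_edges \<and> recolor x y = c"
      if "{x, y} \<in> E" for x y
      using KW[OF that] c that by (auto split: if_splits)
    have "dominating_color E K u v c"
      using dom iff unfolding dominating_color_def by blast
    then show ?thesis ..
  qed
  ultimately show ?thesis using K by blast
qed

end

section \<open>Color classes and used colors\<close>

lemma color_classes_eq: "color_classes G c = (\<lambda>a. {f \<in> edges G. c f = a}) ` c ` edges G"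
  unfolding color_classes_def by auto

lemma inj_on_color_class: "inj_on (\<lambda>a. {f \<in> edges G. c f = a}) (c ` edges G)"
  by (rule inj_onI) blast

lemma finite_color_classes: "finite (color_classes G c) \<longleftrightarrow> finite (c ` edges G)"
  unfolding color_classes_eq using inj_on_color_class by (rule finite_image_iff)

lemma card_color_classes: "card (color_classes G c) = card (c ` edges G)"
  unfolding color_classes_eq using inj_on_color_class by (rule card_image)

lemma tde_coloring_iff:
  "tde_coloring G c \<longleftrightarrow> proper_edge_coloring G c \<and>
     (\<forall>e\<in>edges G. \<exists>a\<in>c ` edges G. \<forall>f\<in>edges G. c f = a \<longrightarrow> adjacent_edges e f)"
  unfolding tde_coloring_def color_classes_eq by (simp add: Ball_def imp_conjL)

section \<open>Edges of the 2- and 3-subdivision\<close>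

definition end_edge :: "nat \<Rightarrow> 'a \<Rightarrow> 'a \<Rightarrow> 'a multiset set" where
  "end_edge k u v = {path_vertex k u v 0, path_vertex k u v 1}"

text \<open>
  Written as an image so that it depends on the unordered edge only; see \<open>middle_edge_eq\<close> for
  the two interior vertices that it joins.
\<close>

definition middle_edge :: "'a set \<Rightarrow> 'a multiset set" where
  "middle_edge e = (\<lambda>u. add_mset u (mset_set e)) ` e"

lemma end_edge_2: "end_edge 2 u v = {{#u, u#}, {#u, v#}}"
  by (simp add: end_edge_def path_vertex_def numeral_eq_Suc add_mset_commute)

lemma end_edge_3: "end_edge 3 u v = {{#u, u, u#}, {#u, u, v#}}"
  by (simp add: end_edge_def path_vertex_def numeral_eq_Suc add_mset_commute)

lemma middle_edge_eq: "u \<noteq> v \<Longrightarrow> middle_edge {u, v} = {{#u, u, v#}, {#v, v, u#}}"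
  by (auto simp: middle_edge_def add_mset_commute)

lemma edges_subdivision_2:
  "edges (subdivision 2 G) = {end_edge 2 u v | u v. {u, v} \<in> edges G}"
proof -
  have "{path_vertex 2 u v i, path_vertex 2 u v (Suc i)} = (if i = 0 then end_edge 2 u v else end_edge 2 v u)"
    if "i < 2" for u v :: 'a and i
    using that unfolding end_edge_2
    by (auto simp: path_vertex_def numeral_eq_Suc less_Suc_eq add_mset_commute)
  note * = this
  show ?thesis
    unfolding subdivision_def snd_conv
  proof (intro set_eqI iffI)
    fix x assume "x \<in> {{path_vertex 2 u v i, path_vertex 2 u v (Suc i)} | u v i. {u, v} \<in> edges G \<and> i < 2}"
    then obtain u v i where x: "{u, v} \<in> edges G" "i < 2"
      "x = {path_vertex 2 u v i, path_vertex 2 u v (Suc i)}" by blast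
    have "{v, u} \<in> edges G" using x(1) by (simp add: insert_commute)
    moreover have "x = end_edge 2 u v \<or> x = end_edge 2 v u"
      using *[OF x(2), of u v] x(3) by presburger
    ultimately show "x \<in> {end_edge 2 u v | u v. {u, v} \<in> edges G}" using x(1) by blast
  next
    fix x assume "x \<in> {end_edge 2 u v | u v. {u, v} \<in> edges G}"
    then obtain u v where x: "{u, v} \<in> edges G" "x = end_edge 2 u v" by blast
    then show "x \<in> {{path_vertex 2 u v i, path_vertex 2 u v (Suc i)} | u v i. {u, v} \<in> edges G \<and> i < 2}"
      using *[of 0 u v] by fastforce
  qed
qed

lemma simple_graph_edge: "simple_graph G \<Longrightarrow> e \<in> edges G \<Longrightarrow> \<exists>u v. e = {u, v} \<and> u \<noteq> v"
  unfolding simple_graph_def nsets_def by (auto simp: card_2_iff)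

lemma simple_graph_neq: "simple_graph G \<Longrightarrow> {u, v} \<in> edges G \<Longrightarrow> u \<noteq> v"
  using simple_graph_edge[of G "{u, v}"] by (auto simp: doubleton_eq_iff)

lemma edges_subdivision_3:
  assumes "simple_graph G"
  shows "edges (subdivision 3 G) =
    {end_edge 3 u v | u v. {u, v} \<in> edges G} \<union> {middle_edge {u, v} | u v. {u, v} \<in> edges G}"
proof -
  have *: "{path_vertex 3 u v i, path_vertex 3 u v (Suc i)} =
      (if i = 0 then end_edge 3 u v else if i = 1 then middle_edge {u, v} else end_edge 3 v u)"
    if "i < 3" "{u, v} \<in> edges G" for u v :: 'a and i
    using that simple_graph_neq[OF assms, of u v] unfolding end_edge_3
    by (auto simp: middle_edge_eq path_vertex_def numeral_eq_Suc less_Suc_eq add_mset_commute)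
  show ?thesis
    unfolding subdivision_def snd_conv
  proof (intro set_eqI iffI)
    fix x assume "x \<in> {{path_vertex 3 u v i, path_vertex 3 u v (Suc i)} | u v i. {u, v} \<in> edges G \<and> i < 3}"
    then show "x \<in> {end_edge 3 u v | u v. {u, v} \<in> edges G} \<union> {middle_edge {u, v} | u v. {u, v} \<in> edges G}"
    proof -
      obtain u v i where x: "{u, v} \<in> edges G" "i < 3"
        "x = {path_vertex 3 u v i, path_vertex 3 u v (Suc i)}"
        using \<open>x \<in> _\<close> by blast
      have "{v, u} \<in> edges G" using x(1) by (simp add: insert_commute)
      moreover have "x = end_edge 3 u v \<or> x = middle_edge {u, v} \<or> x = end_edge 3 v u"
        using *[OF x(2,1)] x(3) by argo
      ultimately show ?thesis using x(1) by blast
    qed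
  next
    fix x assume "x \<in> {end_edge 3 u v | u v. {u, v} \<in> edges G} \<union> {middle_edge {u, v} | u v. {u, v} \<in> edges G}"
    then obtain u v where uv: "{u, v} \<in> edges G" "x = end_edge 3 u v \<or> x = middle_edge {u, v}" by blast
    then have "\<exists>i<3. x = {path_vertex 3 u v i, path_vertex 3 u v (Suc i)}"
      using *[of 0 u v] *[of 1 u v]
      by (metis One_nat_def numeral_3_eq_3 one_less_numeral_iff semiring_norm(77) zero_less_Suc zero_neq_one)
    then show "x \<in> {{path_vertex 3 u v i, path_vertex 3 u v (Suc i)} | u v i. {u, v} \<in> edges G \<and> i < 3}"
      using uv by blast
  qed
qed

lemma end_edge_2_inj:
  "u \<noteq> v \<Longrightarrow> x \<noteq> y \<Longrightarrow> end_edge 2 u v = end_edge 2 x y \<longleftrightarrow> u = x \<and> v = y"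
  by (auto simp: end_edge_2 doubleton_eq_iff add_eq_conv_ex)

lemma adjacent_end_edge_2:
  "u \<noteq> v \<Longrightarrow> x \<noteq> y \<Longrightarrow> adjacent_edges (end_edge 2 u v) (end_edge 2 x y) \<longleftrightarrow>
    x = v \<and> y = u \<or> x = u \<and> y \<noteq> v"
  unfolding adjacent_edges_def end_edge_2_inj
  by (auto simp: end_edge_2 add_eq_conv_ex)

lemma adjacent_end_edge_3:
  "u \<noteq> v \<Longrightarrow> x \<noteq> y \<Longrightarrow> adjacent_edges (end_edge 3 u v) (end_edge 3 x y) \<longleftrightarrow> x = u \<and> y \<noteq> v"
  unfolding adjacent_edges_def by (auto simp: end_edge_3 doubleton_eq_iff add_eq_conv_ex)

lemma adjacent_end_middle:
  "u \<noteq> v \<Longrightarrow> x \<noteq> y \<Longrightarrow> adjacent_edges (end_edge 3 u v) (middle_edge {x, y}) \<longleftrightarrow> {u, v} = {x, y}"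
  unfolding adjacent_edges_def by (auto simp: end_edge_3 middle_edge_eq doubleton_eq_iff add_eq_conv_ex)

lemma adjacent_middle_middle:
  "u \<noteq> v \<Longrightarrow> x \<noteq> y \<Longrightarrow> \<not> adjacent_edges (middle_edge {u, v}) (middle_edge {x, y})"
  unfolding adjacent_edges_def by (auto simp: middle_edge_eq doubleton_eq_iff add_eq_conv_ex)

lemma adjacent_edges_sym: "adjacent_edges e f \<longleftrightarrow> adjacent_edges f e"
  unfolding adjacent_edges_def by auto

section \<open>Transfer between subdivisions and arcs\<close>

lemma thirds_coloring_of_tde_coloring:
  fixes G :: "'a graph"
  assumes simple: "simple_graph G"
    and c: "tde_coloring (subdivision 3 G) c"
  shows "\<exists>\<alpha>. thirds_coloring (edges G) (\<lambda>u v. c (end_edge 3 u v)) (\<lambda>e. c (middle_edge e)) \<alpha>"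
proof -
  note G = simple_graph_edge[OF simple] and neq = simple_graph_neq[OF simple]
    and ed = edges_subdivision_3[OF simple]
  have end_in: "end_edge 3 u v \<in> edges (subdivision 3 G)"
    and mid_in: "middle_edge {u, v} \<in> edges (subdivision 3 G)" if "{u, v} \<in> edges G" for u v
    unfolding ed using that by auto
  have mid_in': "middle_edge e \<in> edges (subdivision 3 G)" if "e \<in> edges G" for e
    using G[OF that] mid_in that by auto
  have proper: "c e \<noteq> c f" if "e \<in> edges (subdivision 3 G)" "f \<in> edges (subdivision 3 G)" "adjacent_edges e f" for e f
    using c that unfolding tde_coloring_def proper_edge_coloring_def by blast
  have dom: "\<exists>a\<in>c ` edges (subdivision 3 G). \<forall>f\<in>edges (subdivision 3 G). c f = a \<longrightarrow> adjacent_edges e f"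
    if "e \<in> edges (subdivision 3 G)" for e
    using c that unfolding tde_coloring_iff by blast
  have color_cases: "(\<exists>x y. {x, y} \<in> edges G \<and> a = c (end_edge 3 x y)) \<or> (\<exists>f\<in>edges G. a = c (middle_edge f))"
    if "a \<in> c ` edges (subdivision 3 G)" for a
    using that unfolding ed by blast
  have "\<exists>a. (\<exists>x y. e = {x, y} \<and> a = c (end_edge 3 x y)) \<and>
      (\<forall>x y. {x, y} \<in> edges G \<longrightarrow> c (end_edge 3 x y) = a \<longrightarrow> {x, y} = e) \<and>
      (\<forall>f\<in>edges G. c (middle_edge f) \<noteq> a)" if e: "e \<in> edges G" for e
  proof -
    obtain u v where uv: "e = {u, v}" "u \<noteq> v" using G[OF e] by blast
    obtain a where a: "a \<in> c ` edges (subdivision 3 G)"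
      and ad: "\<And>f. f \<in> edges (subdivision 3 G) \<Longrightarrow> c f = a \<Longrightarrow> adjacent_edges (middle_edge e) f"
      using dom[OF mid_in'[OF e]] by blast
    have 1: "{x, y} = e" if "{x, y} \<in> edges G" "c (end_edge 3 x y) = a" for x y
      using ad[OF end_in[OF that(1)] that(2)] neq[OF that(1)] uv
      by (simp add: adjacent_end_middle adjacent_edges_sym[of "middle_edge {u, v}"])
    have 2: "c (middle_edge f) \<noteq> a" if f: "f \<in> edges G" for f
    proof
      assume "c (middle_edge f) = a"
      then have "adjacent_edges (middle_edge e) (middle_edge f)" using ad mid_in'[OF f] by blast
      then show False using G[OF f] uv adjacent_middle_middle by metis
    qed
    show ?thesis using color_cases[OF a] 1 2 by metis
  qed
  then obtain \<alpha> where \<alpha>: "\<And>e. e \<in> edges G \<Longrightarrow> (\<exists>x y. e = {x, y} \<and> \<alpha> e = c (end_edge 3 x y)) \<and>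
      (\<forall>x y. {x, y} \<in> edges G \<longrightarrow> c (end_edge 3 x y) = \<alpha> e \<longrightarrow> {x, y} = e) \<and>
      (\<forall>f\<in>edges G. c (middle_edge f) \<noteq> \<alpha> e)" by metis
  have "thirds_coloring (edges G) (\<lambda>u v. c (end_edge 3 u v)) (\<lambda>e. c (middle_edge e)) \<alpha>"
  proof
    fix u v w assume a: "{u, v} \<in> edges G" "{u, w} \<in> edges G" "v \<noteq> w"
    show "c (end_edge 3 u v) \<noteq> c (end_edge 3 u w)"
      using proper[OF end_in[OF a(1)] end_in[OF a(2)]] adjacent_end_edge_3[of u v u w]
        neq[OF a(1)] neq[OF a(2)] a(3) by simp
  next
    fix u v assume a: "{u, v} \<in> edges G"
    show "c (end_edge 3 u v) \<noteq> c (middle_edge {u, v})"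
      using proper[OF end_in[OF a] mid_in[OF a]] adjacent_end_middle[of u v u v]
        neq[OF a] by simp
    show "\<alpha> {u, v} = c (end_edge 3 u v) \<or> \<alpha> {u, v} = c (end_edge 3 v u)"
      using \<alpha>[OF a] by (auto simp: doubleton_eq_iff)
    obtain b where b: "b \<in> c ` edges (subdivision 3 G)"
      and ad: "\<And>f. f \<in> edges (subdivision 3 G) \<Longrightarrow> c f = b \<Longrightarrow> adjacent_edges (end_edge 3 u v) f"
      using dom[OF end_in[OF a]] by blast
    have 1: "x = u \<and> y \<noteq> v" if "{x, y} \<in> edges G" "c (end_edge 3 x y) = b" for x y
      using ad[OF end_in[OF that(1)] that(2)] neq[OF that(1)] neq[OF a] adjacent_end_edge_3 by metis
    have 2: "f = {u, v}" if f: "f \<in> edges G" "c (middle_edge f) = b" for f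
      using ad[OF mid_in'[OF f(1)] f(2)] G[OF f(1)] neq[OF a] adjacent_end_middle by metis
    show "\<exists>b. (b = c (middle_edge {u, v}) \<or> (\<exists>w. w \<noteq> v \<and> {u, w} \<in> edges G \<and> b = c (end_edge 3 u w))) \<and>
       (\<forall>x y. {x, y} \<in> edges G \<longrightarrow> c (end_edge 3 x y) = b \<longrightarrow> x = u \<and> y \<noteq> v) \<and>
       (\<forall>f\<in>edges G. c (middle_edge f) = b \<longrightarrow> f = {u, v})"
    proof (intro exI[of _ b] conjI)
      show "b = c (middle_edge {u, v}) \<or> (\<exists>w. w \<noteq> v \<and> {u, w} \<in> edges G \<and> b = c (end_edge 3 u w))"
        using color_cases[OF b] 1 2 by blast
    qed (use 1 2 in blast)+
  qed (use G \<alpha> in blast)+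
  then show ?thesis by blast
qed

lemma tde_coloring_halves:
  fixes G :: "'a graph" and K :: "'a \<Rightarrow> 'a \<Rightarrow> 'c"
  assumes simple: "simple_graph G"
    and K: "proper_arcs (edges G) K"
    and dom: "\<And>u v. {u, v} \<in> edges G \<Longrightarrow> \<exists>c. dominating_color (edges G) K u v c"
  shows "\<exists>c. tde_coloring (subdivision 2 G) c \<and> (\<forall>u v. {u, v} \<in> edges G \<longrightarrow> c (end_edge 2 u v) = K u v)"
proof -
  note neq = simple_graph_neq[OF simple]
  define c where "c h = (case (SOME (u, v). {u, v} \<in> edges G \<and> h = end_edge 2 u v) of (u, v) \<Rightarrow> K u v)" for h
  have c: "c (end_edge 2 u v) = K u v" if "{u, v} \<in> edges G" for u v
  proof -
    have "(SOME (x, y). {x, y} \<in> edges G \<and> end_edge 2 u v = end_edge 2 x y) = (u, v)"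
    proof (rule some_equality)
      fix p assume "case p of (x, y) \<Rightarrow> {x, y} \<in> edges G \<and> end_edge 2 u v = end_edge 2 x y"
      then show "p = (u, v)"
        using end_edge_2_inj[OF neq[OF that], of "fst p" "snd p"] neq[of "fst p" "snd p"]
        by (cases p) simp
    qed (simp add: that)
    then show ?thesis by (simp add: c_def)
  qed
  have "tde_coloring (subdivision 2 G) c"
    unfolding tde_coloring_iff proper_edge_coloring_def
  proof (intro conjI ballI impI)
    fix e f assume "e \<in> edges (subdivision 2 G)" "f \<in> edges (subdivision 2 G)" and ad: "adjacent_edges e f"
    then obtain u v x y where e: "{u, v} \<in> edges G" "e = end_edge 2 u v"
      and f: "{x, y} \<in> edges G" "f = end_edge 2 x y" unfolding edges_subdivision_2 by blast
    then have "x = v \<and> y = u \<or> x = u \<and> y \<noteq> v" using ad neq adjacent_end_edge_2 by metis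
    then show "c e \<noteq> c f" using c[OF e(1)] c[OF f(1)] e f K unfolding proper_arcs_def by metis
  next
    fix e assume "e \<in> edges (subdivision 2 G)"
    then obtain u v where e: "{u, v} \<in> edges G" "e = end_edge 2 u v" unfolding edges_subdivision_2 by blast
    obtain x y where xy: "{x, y} \<in> edges G"
      and d: "\<And>z w. {z, w} \<in> edges G \<Longrightarrow> K z w = K x y \<Longrightarrow> z = v \<and> w = u \<or> z = u \<and> w \<noteq> v"
      using dom[OF e(1)] unfolding dominating_color_def by blast
    show "\<exists>a\<in>c ` edges (subdivision 2 G). \<forall>f\<in>edges (subdivision 2 G). c f = a \<longrightarrow> adjacent_edges e f"
    proof (intro bexI[of _ "K x y"] ballI impI)
      fix f assume "f \<in> edges (subdivision 2 G)" and cf: "c f = K x y"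
      then obtain z w where f: "{z, w} \<in> edges G" "f = end_edge 2 z w" unfolding edges_subdivision_2 by blast
      then have "z = v \<and> w = u \<or> z = u \<and> w \<noteq> v" using d[OF f(1)] c[OF f(1)] cf by auto
      then show "adjacent_edges e f" using e f neq adjacent_end_edge_2 by metis
    next
      show "K x y \<in> c ` edges (subdivision 2 G)" unfolding edges_subdivision_2 using xy c[OF xy] by force
    qed
  qed
  then show ?thesis using c by blast
qed

text \<open>
  The new coloring reuses colors of the old one, so the number of classes cannot grow.
\<close>

lemma tde_coloring_half_subdivision:
  fixes G :: "'a graph"
  assumes G: "simple_graph G" and c: "tde_coloring (subdivision 3 G) c"
    and fin: "finite (color_classes (subdivision 3 G) c)"
  shows "\<exists>d. tde_coloring (subdivision 2 G) d \<and>
    d ` edges (subdivision 2 G) \<subseteq> c ` edges (subdivision 3 G)"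
proof -
  obtain \<alpha> where "thirds_coloring (edges G) (\<lambda>u v. c (end_edge 3 u v)) (\<lambda>e. c (middle_edge e)) \<alpha>"
    using thirds_coloring_of_tde_coloring[OF G c] by blast
  then interpret thirds_coloring "edges G" "\<lambda>u v. c (end_edge 3 u v)" "\<lambda>e. c (middle_edge e)" \<alpha> .
  have "c (middle_edge e) \<in> c ` edges (subdivision 3 G)" if "e \<in> edges G" for e
  proof -
    obtain u v where "e = {u, v}" using simple_graph_edge[OF G \<open>e \<in> edges G\<close>] by blast
    then have "middle_edge e \<in> edges (subdivision 3 G)"
      using that unfolding edges_subdivision_3[OF G] by blast
    then show ?thesis by (rule imageI)
  qed
  then have colors: "colors \<subseteq> c ` edges (subdivision 3 G)"
    unfolding colors_def edges_subdivision_3[OF G] by blast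
  then have "finite colors" using fin finite_color_classes finite_subset by blast
  from ex_halves_coloring[OF this] obtain K where K: "proper_arcs (edges G) K"
    and Kc: "\<And>u v. {u, v} \<in> edges G \<Longrightarrow> K u v \<in> colors"
    and Kd: "\<And>u v. {u, v} \<in> edges G \<Longrightarrow> \<exists>c. dominating_color (edges G) K u v c"
    by blast
  obtain d where d: "tde_coloring (subdivision 2 G) d"
    and dK: "\<And>u v. {u, v} \<in> edges G \<Longrightarrow> d (end_edge 2 u v) = K u v"
    using tde_coloring_halves[OF G K Kd] by blast
  have "d ` edges (subdivision 2 G) \<subseteq> colors"
    unfolding edges_subdivision_2 using dK Kc by auto
  then show ?thesis using d colors by blast
qed

theorem theorem4p10:
  fixes G :: "'a graph"
  assumes "simple_graph G"
  shows "tde_chromatic_number (subdivision 2 G) \<le> tde_chromatic_number (subdivision 3 G)"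
  unfolding tde_chromatic_number_def
proof (rule Inf_mono, clarify)
  fix c :: "'a multiset set \<Rightarrow> nat"
  assume c: "tde_coloring (subdivision 3 G) c" and fin: "finite (color_classes (subdivision 3 G) c)"
  obtain d where d: "tde_coloring (subdivision 2 G) d"
    and sub: "d ` edges (subdivision 2 G) \<subseteq> c ` edges (subdivision 3 G)"
    using tde_coloring_half_subdivision[OF assms c fin] by blast
  have fin': "finite (c ` edges (subdivision 3 G))" using fin finite_color_classes by blast
  have "finite (color_classes (subdivision 2 G) d)"
    unfolding finite_color_classes using sub fin' by (rule finite_subset)
  moreover have "card (color_classes (subdivision 2 G) d) \<le> card (color_classes (subdivision 3 G) c)"
    unfolding card_color_classes using fin' sub by (rule card_mono)
  ultimately show "\<exists>a\<in>{enat (card (color_classes (subdivision 2 G) c)) | c :: 'a multiset set \<Rightarrow> nat.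
      tde_coloring (subdivision 2 G) c \<and> finite (color_classes (subdivision 2 G) c)}.
      a \<le> enat (card (color_classes (subdivision 3 G) c))"
    using d by (intro bexI[of _ "enat (card (color_classes (subdivision 2 G) d))"]) (simp, blast)
qed

end
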